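(* Let $(M,g,\Pi)$ be a Riemannian Poisson manifold with contravariant Levi-Civita connection $\mathcal{D}$. A 1-form $\eta\in\Omega^1(M)$ is a Killing 1-form if and only if $$g(\mathcal{D}_\alpha\eta,\alpha)=0$$ for every 1-form $\alpha\in\Omega^1(M)$.
   Context: Let $M$ be a smooth manifold with a Poisson tensor $\Pi$ (a bivector field with vanishing Schouten bracket $[\Pi,\Pi]_S=0$), and let $\Omega^1(M)$ denote the smooth 1-forms. The sharp map $\sharp_\Pi:T^*M\to TM$ is defined by $\eta(\sharp_\Pi(\omega))=\Pi(\omega,\eta)$. The Koszul bracket on 1-forms is $[\omega,\eta]_\Pi=\mathcal{L}_{\sharp_\Pi(\omega)}\eta-\mathcal{L}_{\sharp_\Pi(\eta)}\omega-d(\Pi(\omega,\eta))$ (here $\mathcal{L}$ is the usual Lie derivative along vector fields). If $\tilde g$ is a pseudo-Riemannian metric on $M$, its cometric $g$ is the metric on $T^*M$ given by $g(\omega,\eta)=\tilde g(\sharp_{\tilde g}\omega,\sharp_{\tilde g}\eta)$, where $\omega(X)=\tilde g(\sharp_{\tilde g}\omega,X)$. The contravariant Levi-Civita connection associated to $(\Pi,g)$ is the unique $\mathbb{R}$-bilinear map $\mathcal{D}:\Omega^1(M)\times\Omega^1(M)\to\Omega^1(M)$ with $\mathcal{D}_{\phi\omega}\eta=\phi\mathcal{D}_\omega\eta$, $\mathcal{D}_\omega(\phi\eta)=\phi\mathcal{D}_\omega\eta+\sharp_\Pi(\omega)(\phi)\eta$ for $\phi\in\mathcal{C}^\infty(M)$,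 which is torsion-free, $\mathcal{D}_\omega\eta-\mathcal{D}_\eta\omega=[\omega,\eta]_\Pi$, and metric, $\sharp_\Pi(\omega)g(\eta,\gamma)=g(\mathcal{D}_\omega\eta,\gamma)+g(\eta,\mathcal{D}_\omega\gamma)$. The triple $(M,g,\Pi)$ is a Riemannian Poisson manifold if $\mathcal{D}\Pi=0$, i.e. $\sharp_\Pi(\omega)\Pi(\eta,\gamma)-\Pi(\mathcal{D}_\omega\eta,\gamma)-\Pi(\eta,\mathcal{D}_\omega\gamma)=0$ for all 1-forms $\omega,\eta,\gamma$. The Lie derivative of $g$ in the direction of a 1-form $\eta$ is $(\mathcal{L}_\eta g)(\alpha,\beta)=\sharp_\Pi(\eta)(g(\alpha,\beta))-g([\eta,\alpha]_\Pi,\beta)-g(\alpha,[\eta,\beta]_\Pi)$. A 1-form $\eta$ is a Killing 1-form if $\mathcal{L}_\eta g=0$. *)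

theory Defs
  imports "HOL-Analysis.Analysis"
begin

section \<open>Smooth maps between Euclidean spaces\<close>

text \<open>Used for open \<open>S\<close> only. In finite dimension, continuity of all iterated
  directional derivatives is the usual \<open>C\<^sup>k\<close> condition.\<close>

primrec Ck_on :: "nat \<Rightarrow> 'e set \<Rightarrow> ('e::euclidean_space \<Rightarrow> 'f::real_normed_vector) \<Rightarrow> bool" where
  "Ck_on 0 S f \<longleftrightarrow> continuous_on S f"
| "Ck_on (Suc k) S f \<longleftrightarrow>
     (\<forall>x\<in>S. f differentiable (at x)) \<and>
     (\<forall>v. Ck_on k S (\<lambda>x. frechet_derivative f (at x) v))"

definition smooth_on :: "'e set \<Rightarrow> ('e::euclidean_space \<Rightarrow> 'f::real_normed_vector) \<Rightarrow> bool" where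
  "smooth_on S f \<longleftrightarrow> (\<forall>k. Ck_on k S f)"


section \<open>Smooth manifolds\<close>

text \<open>The manifold is the Hausdorff, second countable space given by a type; its dimension
  is \<open>DIM('e)\<close>. A chart is a pair (domain, coordinate map).\<close>

type_synonym ('m, 'e) chart = "'m set \<times> ('m \<Rightarrow> 'e)"

abbreviation chart_inv :: "('m, 'e) chart \<Rightarrow> 'e \<Rightarrow> 'm" where
  "chart_inv c \<equiv> inv_into (fst c) (snd c)"

abbreviation chart_image :: "('m, 'e) chart \<Rightarrow> 'e set" where
  "chart_image c \<equiv> snd c ` fst c"

definition smooth_atlas ::
  "('m::{t2_space, second_countable_topology}, 'e::euclidean_space) chart set \<Rightarrow> bool" where
  "smooth_atlas A \<longleftrightarrow>
     (\<Union>c\<in>A. fst c) = UNIV \<and>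
     (\<forall>c\<in>A. open (fst c) \<and> open (chart_image c) \<and>
        homeomorphism (fst c) (chart_image c) (snd c) (chart_inv c)) \<and>
     (\<forall>c\<in>A. \<forall>c'\<in>A. smooth_on (snd c ` (fst c \<inter> fst c')) (snd c' \<circ> chart_inv c))"

text \<open>Each point gets a preferred chart, and the tangent space at \<open>p\<close> is identified with
  \<open>'e\<close> through the preferred chart at \<open>p\<close>. Accordingly the cotangent space at \<open>p\<close> is the dual
  of \<open>'e\<close>. Since the preferred chart jumps from point to point, smoothness of a tensor field is
  always a condition on its components in each chart of the atlas.\<close>

definition chart_at :: "('m, 'e) chart set \<Rightarrow> 'm \<Rightarrow> ('m, 'e) chart" where
  "chart_at A p = (SOME c. c \<in> A \<and> p \<in> fst c)"

text \<open>Change of coordinates for tangent vectors at \<open>p\<close>, from \<open>c\<close>-coordinates to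
  \<open>c'\<close>-coordinates.\<close>

definition transition ::
  "('m, 'e::euclidean_space) chart \<Rightarrow> ('m, 'e) chart \<Rightarrow> 'm \<Rightarrow> 'e \<Rightarrow> 'e" where
  "transition c c' p = frechet_derivative (snd c' \<circ> chart_inv c) (at (snd c p))"

text \<open>\<open>coord_vec A c p b\<close> is the tangent vector at \<open>p\<close> whose \<open>c\<close>-coordinates are \<open>b\<close>;
  \<open>coord_covec A c p a\<close> is the covector at \<open>p\<close> whose \<open>c\<close>-coordinates are \<open>a\<close>. For \<open>b\<close> in the
  standard basis and \<open>a\<close> in its dual basis these are the coordinate fields and the differentials
  of the coordinate functions.\<close>

definition coord_vec ::
  "('m, 'e::euclidean_space) chart set \<Rightarrow> ('m, 'e) chart \<Rightarrow> 'm \<Rightarrow> 'e \<Rightarrow> 'e" where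
  "coord_vec A c p b = transition c (chart_at A p) p b"

definition coord_covec ::
  "('m, 'e::euclidean_space) chart set \<Rightarrow> ('m, 'e) chart \<Rightarrow> 'm \<Rightarrow> ('e \<Rightarrow>\<^sub>L real) \<Rightarrow> ('e \<Rightarrow>\<^sub>L real)" where
  "coord_covec A c p a = Blinfun (\<lambda>v. blinfun_apply a (transition (chart_at A p) c p v))"

definition smooth_fun ::
  "('m, 'e::euclidean_space) chart set \<Rightarrow> ('m \<Rightarrow> real) \<Rightarrow> bool" where
  "smooth_fun A f \<longleftrightarrow> (\<forall>c\<in>A. smooth_on (chart_image c) (f \<circ> chart_inv c))"


section \<open>Tensor fields\<close>

type_synonym ('m, 'e) vector_field = "'m \<Rightarrow> 'e"
type_synonym ('m, 'e) covector_field = "'m \<Rightarrow> ('e \<Rightarrow>\<^sub>L real)"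
type_synonym ('m, 'e) covariant2 = "'m \<Rightarrow> 'e \<Rightarrow> 'e \<Rightarrow> real"
type_synonym ('m, 'e) contravariant2 = "'m \<Rightarrow> ('e \<Rightarrow>\<^sub>L real) \<Rightarrow> ('e \<Rightarrow>\<^sub>L real) \<Rightarrow> real"

definition one_forms ::
  "('m, 'e::euclidean_space) chart set \<Rightarrow> ('m, 'e) covector_field set" where
  "one_forms A = {\<omega>. \<forall>c\<in>A. \<forall>b. smooth_on (chart_image c)
     (\<lambda>x. let p = chart_inv c x in blinfun_apply (\<omega> p) (coord_vec A c p b))}"

text \<open>Evaluation of a contravariant 2-tensor field on two 1-forms.\<close>

definition eval2 ::
  "('m, 'e::euclidean_space) contravariant2 \<Rightarrow> ('m, 'e) covector_field \<Rightarrow> ('m, 'e) covector_field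
     \<Rightarrow> 'm \<Rightarrow> real" where
  "eval2 T \<omega> \<eta> = (\<lambda>p. T p (\<omega> p) (\<eta> p))"

definition differential ::
  "('m, 'e::euclidean_space) chart set \<Rightarrow> ('m \<Rightarrow> real) \<Rightarrow> ('m, 'e) covector_field" where
  "differential A f = (\<lambda>p. Blinfun
     (frechet_derivative (f \<circ> chart_inv (chart_at A p)) (at (snd (chart_at A p) p))))"

definition vf_apply ::
  "('m, 'e::euclidean_space) chart set \<Rightarrow> ('m, 'e) vector_field \<Rightarrow> ('m \<Rightarrow> real) \<Rightarrow> 'm \<Rightarrow> real" where
  "vf_apply A X f = (\<lambda>p. blinfun_apply (differential A f p) (X p))"

text \<open>The Lie derivative of a 1-form along a vector field, by the coordinate formula
  \<open>(L\<^sub>X \<eta>)\<^sub>i = X\<^sup>j \<partial>\<^sub>j \<eta>\<^sub>i + \<eta>\<^sub>j \<partial>\<^sub>i X\<^sup>j\<close> evaluated at \<open>p\<close> in the preferred chart at \<open>p\<close>.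
  The derivatives are those of the components in this fixed chart.\<close>

definition lie_derivative_form ::
  "('m, 'e::euclidean_space) chart set \<Rightarrow> ('m, 'e) vector_field \<Rightarrow> ('m, 'e) covector_field
     \<Rightarrow> ('m, 'e) covector_field" where
  "lie_derivative_form A X \<eta> = (\<lambda>p.
     let c = chart_at A p;
         \<eta>c = (\<lambda>v x. let q = chart_inv c x in blinfun_apply (\<eta> q) (coord_vec A c q v));
         Xc = (\<lambda>x. let q = chart_inv c x in transition (chart_at A q) c q (X q))
     in Blinfun (\<lambda>v.
          frechet_derivative (\<eta>c v) (at (snd c p)) (X p) +
          blinfun_apply (\<eta> p) (frechet_derivative Xc (at (snd c p)) v)))"


section \<open>Poisson tensors\<close>

definition bivector_field ::
  "('m, 'e::euclidean_space) chart set \<Rightarrow> ('m, 'e) contravariant2 \<Rightarrow> bool" where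
  "bivector_field A P \<longleftrightarrow>
     (\<forall>p. bilinear (P p) \<and> (\<forall>a b. P p a b = - P p b a)) \<and>
     (\<forall>c\<in>A. \<forall>a b. smooth_on (chart_image c)
        (\<lambda>x. let p = chart_inv c x in P p (coord_covec A c p a) (coord_covec A c p b)))"

definition bivector_bracket ::
  "('m, 'e::euclidean_space) chart set \<Rightarrow> ('m, 'e) contravariant2 \<Rightarrow> ('m \<Rightarrow> real) \<Rightarrow> ('m \<Rightarrow> real)
     \<Rightarrow> 'm \<Rightarrow> real" where
  "bivector_bracket A P f h = eval2 P (differential A f) (differential A h)"

text \<open>The Schouten bracket of two bivector fields, a trivector field, given through its values
  on exact 1-forms \<open>df, dh, dk\<close>. This is the shuffle formula for the Schouten bracket of two
  skew-symmetric biderivations.\<close>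

definition schouten_bracket ::
  "('m, 'e::euclidean_space) chart set \<Rightarrow> ('m, 'e) contravariant2 \<Rightarrow> ('m, 'e) contravariant2
     \<Rightarrow> ('m \<Rightarrow> real) \<Rightarrow> ('m \<Rightarrow> real) \<Rightarrow> ('m \<Rightarrow> real) \<Rightarrow> 'm \<Rightarrow> real" where
  "schouten_bracket A P Q f h k =
     (let PQ = (\<lambda>f h k. bivector_bracket A P (bivector_bracket A Q f h) k);
          QP = (\<lambda>f h k. bivector_bracket A Q (bivector_bracket A P f h) k)
      in (\<lambda>p. PQ f h k p + PQ h k f p + PQ k f h p + QP f h k p + QP h k f p + QP k f h p))"

definition poisson_tensor ::
  "('m, 'e::euclidean_space) chart set \<Rightarrow> ('m, 'e) contravariant2 \<Rightarrow> bool" where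
  "poisson_tensor A \<pi> \<longleftrightarrow>
     bivector_field A \<pi> \<and>
     (\<forall>f h k. smooth_fun A f \<longrightarrow> smooth_fun A h \<longrightarrow> smooth_fun A k \<longrightarrow>
        schouten_bracket A \<pi> \<pi> f h k = (\<lambda>_. 0))"

definition poisson_sharp ::
  "('m, 'e::euclidean_space) contravariant2 \<Rightarrow> ('m, 'e) covector_field \<Rightarrow> ('m, 'e) vector_field" where
  "poisson_sharp \<pi> \<omega> = (\<lambda>p. THE v. \<forall>\<eta>. blinfun_apply \<eta> v = \<pi> p (\<omega> p) \<eta>)"

definition koszul_bracket ::
  "('m, 'e::euclidean_space) chart set \<Rightarrow> ('m, 'e) contravariant2
     \<Rightarrow> ('m, 'e) covector_field \<Rightarrow> ('m, 'e) covector_field \<Rightarrow> ('m, 'e) covector_field" where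
  "koszul_bracket A \<pi> \<omega> \<eta> = (\<lambda>p.
     lie_derivative_form A (poisson_sharp \<pi> \<omega>) \<eta> p
     - lie_derivative_form A (poisson_sharp \<pi> \<eta>) \<omega> p
     - differential A (eval2 \<pi> \<omega> \<eta>) p)"


section \<open>Cometrics and contravariant connections\<close>

definition pseudo_riemannian_metric ::
  "('m, 'e::euclidean_space) chart set \<Rightarrow> ('m, 'e) covariant2 \<Rightarrow> bool" where
  "pseudo_riemannian_metric A gt \<longleftrightarrow>
     (\<forall>p. bilinear (gt p) \<and> (\<forall>v w. gt p v w = gt p w v) \<and>
          (\<forall>v. (\<forall>w. gt p v w = 0) \<longrightarrow> v = 0)) \<and>
     (\<forall>c\<in>A. \<forall>a b. smooth_on (chart_image c)
        (\<lambda>x. let p = chart_inv c x in gt p (coord_vec A c p a) (coord_vec A c p b)))"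

definition metric_sharp ::
  "('m, 'e::euclidean_space) covariant2 \<Rightarrow> 'm \<Rightarrow> ('e \<Rightarrow>\<^sub>L real) \<Rightarrow> 'e" where
  "metric_sharp gt p a = (THE v. \<forall>w. blinfun_apply a w = gt p v w)"

definition cometric ::
  "('m, 'e::euclidean_space) covariant2 \<Rightarrow> ('m, 'e) contravariant2" where
  "cometric gt = (\<lambda>p a b. gt p (metric_sharp gt p a) (metric_sharp gt p b))"

text \<open>\<open>D\<close> is the contravariant Levi-Civita connection of \<open>(\<pi>, g)\<close>. Only the values of \<open>D\<close> on
  smooth 1-forms are constrained; they are determined uniquely.\<close>

definition contravariant_levi_civita ::
  "('m, 'e::euclidean_space) chart set \<Rightarrow> ('m, 'e) contravariant2 \<Rightarrow> ('m, 'e) contravariant2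
     \<Rightarrow> (('m, 'e) covector_field \<Rightarrow> ('m, 'e) covector_field \<Rightarrow> ('m, 'e) covector_field) \<Rightarrow> bool" where
  "contravariant_levi_civita A g \<pi> D \<longleftrightarrow>
     (\<forall>\<omega>\<in>one_forms A. \<forall>\<eta>\<in>one_forms A. D \<omega> \<eta> \<in> one_forms A) \<and>
     (\<forall>\<omega>\<in>one_forms A. \<forall>\<omega>'\<in>one_forms A. \<forall>\<eta>\<in>one_forms A.
        D (\<lambda>p. \<omega> p + \<omega>' p) \<eta> = (\<lambda>p. D \<omega> \<eta> p + D \<omega>' \<eta> p) \<and>
        D \<eta> (\<lambda>p. \<omega> p + \<omega>' p) = (\<lambda>p. D \<eta> \<omega> p + D \<eta> \<omega>' p)) \<and>
     (\<forall>r. \<forall>\<omega>\<in>one_forms A. \<forall>\<eta>\<in>one_forms A.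
        D (\<lambda>p. r *\<^sub>R \<omega> p) \<eta> = (\<lambda>p. r *\<^sub>R D \<omega> \<eta> p) \<and>
        D \<omega> (\<lambda>p. r *\<^sub>R \<eta> p) = (\<lambda>p. r *\<^sub>R D \<omega> \<eta> p)) \<and>
     (\<forall>\<phi>. smooth_fun A \<phi> \<longrightarrow> (\<forall>\<omega>\<in>one_forms A. \<forall>\<eta>\<in>one_forms A.
        D (\<lambda>p. \<phi> p *\<^sub>R \<omega> p) \<eta> = (\<lambda>p. \<phi> p *\<^sub>R D \<omega> \<eta> p) \<and>
        D \<omega> (\<lambda>p. \<phi> p *\<^sub>R \<eta> p) =
          (\<lambda>p. \<phi> p *\<^sub>R D \<omega> \<eta> p + vf_apply A (poisson_sharp \<pi> \<omega>) \<phi> p *\<^sub>R \<eta> p))) \<and>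
     (\<forall>\<omega>\<in>one_forms A. \<forall>\<eta>\<in>one_forms A.
        (\<lambda>p. D \<omega> \<eta> p - D \<eta> \<omega> p) = koszul_bracket A \<pi> \<omega> \<eta>) \<and>
     (\<forall>\<omega>\<in>one_forms A. \<forall>\<eta>\<in>one_forms A. \<forall>\<gamma>\<in>one_forms A.
        vf_apply A (poisson_sharp \<pi> \<omega>) (eval2 g \<eta> \<gamma>) =
          (\<lambda>p. eval2 g (D \<omega> \<eta>) \<gamma> p + eval2 g \<eta> (D \<omega> \<gamma>) p))"

definition parallel_bivector ::
  "('m, 'e::euclidean_space) chart set
     \<Rightarrow> (('m, 'e) covector_field \<Rightarrow> ('m, 'e) covector_field \<Rightarrow> ('m, 'e) covector_field)
     \<Rightarrow> ('m, 'e) contravariant2 \<Rightarrow> bool" where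
  "parallel_bivector A D \<pi> \<longleftrightarrow>
     (\<forall>\<omega>\<in>one_forms A. \<forall>\<eta>\<in>one_forms A. \<forall>\<gamma>\<in>one_forms A. \<forall>p.
        vf_apply A (poisson_sharp \<pi> \<omega>) (eval2 \<pi> \<eta> \<gamma>) p
        - eval2 \<pi> (D \<omega> \<eta>) \<gamma> p - eval2 \<pi> \<eta> (D \<omega> \<gamma>) p = 0)"

definition riemannian_poisson_manifold ::
  "('m::{t2_space, second_countable_topology}, 'e::euclidean_space) chart set
     \<Rightarrow> ('m, 'e) contravariant2 \<Rightarrow> ('m, 'e) contravariant2 \<Rightarrow> bool" where
  "riemannian_poisson_manifold A g \<pi> \<longleftrightarrow>
     smooth_atlas A \<and> poisson_tensor A \<pi> \<and>
     (\<exists>gt. pseudo_riemannian_metric A gt \<and> g = cometric gt) \<and>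
     (\<exists>D. contravariant_levi_civita A g \<pi> D \<and> parallel_bivector A D \<pi>)"


section \<open>Killing 1-forms\<close>

definition lie_derivative_cometric ::
  "('m, 'e::euclidean_space) chart set \<Rightarrow> ('m, 'e) contravariant2 \<Rightarrow> ('m, 'e) contravariant2
     \<Rightarrow> ('m, 'e) covector_field \<Rightarrow> ('m, 'e) covector_field \<Rightarrow> ('m, 'e) covector_field
     \<Rightarrow> 'm \<Rightarrow> real" where
  "lie_derivative_cometric A g \<pi> \<eta> \<alpha> \<beta> = (\<lambda>p.
     vf_apply A (poisson_sharp \<pi> \<eta>) (eval2 g \<alpha> \<beta>) p
     - eval2 g (koszul_bracket A \<pi> \<eta> \<alpha>) \<beta> p
     - eval2 g \<alpha> (koszul_bracket A \<pi> \<eta> \<beta>) p)"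

definition killing_form ::
  "('m, 'e::euclidean_space) chart set \<Rightarrow> ('m, 'e) contravariant2 \<Rightarrow> ('m, 'e) contravariant2
     \<Rightarrow> ('m, 'e) covector_field \<Rightarrow> bool" where
  "killing_form A g \<pi> \<eta> \<longleftrightarrow>
     \<eta> \<in> one_forms A \<and>
     (\<forall>\<alpha>\<in>one_forms A. \<forall>\<beta>\<in>one_forms A. lie_derivative_cometric A g \<pi> \<eta> \<alpha> \<beta> = (\<lambda>_. 0))"

end

theory Submission
  imports Defs
begin

text \<open>Substituting the torsion-free identity \<open>[\<eta>, \<alpha>]\<^sub>\<Pi> = D\<^sub>\<eta> \<alpha> - D\<^sub>\<alpha> \<eta>\<close> into the Lie derivative
  of the cometric, and cancelling the \<open>D\<^sub>\<eta>\<close> terms against \<open>\<sharp>(\<eta>) g(\<alpha>, \<beta>)\<close> by metric compatibility,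
  leaves
  \<open>(L\<^sub>\<eta> g)(\<alpha>, \<beta>) = g(D\<^sub>\<alpha> \<eta>, \<beta>) + g(\<alpha>, D\<^sub>\<beta> \<eta>)\<close>
  (lemma \<open>lie_derivative_cometric_levi_civita\<close>).
  So the 1-form \<open>\<eta>\<close> is Killing exactly when \<open>(\<alpha>, \<beta>) \<mapsto> g(D\<^sub>\<alpha> \<eta>, \<beta>)\<close> is skew-symmetric. As this
  expression is biadditive in \<open>(\<alpha>, \<beta>)\<close>, skew-symmetry amounts to its vanishing on the
  diagonal: one direction is \<open>\<beta> = \<alpha>\<close>, the other is polarization, which evaluates the quadratic
  expression at \<open>\<alpha> + \<beta>\<close>.

  Polarization needs smooth 1-forms to be closed under addition (lemma \<open>one_forms_add\<close>) and the
  cometric to be symmetric and additive. Symmetry is inherited from the metric; additivity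
  rests on its nondegeneracy, through which every covector has a sharp
  (lemma \<open>metric_sharp_represents\<close>).\<close>

text \<open>The function \<open>h\<close> is only required to agree with \<open>f + g\<close> on \<open>S\<close>: iterated derivatives satisfy
  the sum rule only where \<open>f\<close> and \<open>g\<close> are differentiable, so this weak form is what the
  induction on \<open>k\<close> reproduces.\<close>

lemma Ck_on_add_cong:
  assumes "open S" "Ck_on k S f" "Ck_on k S g" "\<And>x. x \<in> S \<Longrightarrow> h x = f x + g x"
  shows "Ck_on k S h"
  using assms(2-4)
proof (induction k arbitrary: f g h)
  case 0
  have "continuous_on S (\<lambda>x. f x + g x)"
    using 0 by (auto intro: continuous_on_add)
  with 0 show ?case
    by (simp cong: continuous_on_cong)
next
  case (Suc k)
  have deriv: "(h has_derivative
      (\<lambda>v. frechet_derivative f (at x) v + frechet_derivative g (at x) v)) (at x)"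
    if "x \<in> S" for x
  proof -
    have "((\<lambda>x. f x + g x) has_derivative
      (\<lambda>v. frechet_derivative f (at x) v + frechet_derivative g (at x) v)) (at x)"
      using Suc.prems(1,2) that
      by (intro has_derivative_add) (simp_all add: frechet_derivative_works[symmetric])
    then show ?thesis
      by (rule has_derivative_transform_within_open[OF _ assms(1) that])
        (simp add: Suc.prems(3))
  qed
  have "frechet_derivative h (at x) v
      = frechet_derivative f (at x) v + frechet_derivative g (at x) v" if "x \<in> S" for x v
    using frechet_derivative_at[OF deriv[OF that]] by metis
  then have "Ck_on k S (\<lambda>x. frechet_derivative h (at x) v)" for v
    using Suc.prems(1,2)
      Suc.IH[of "\<lambda>x. frechet_derivative f (at x) v" "\<lambda>x. frechet_derivative g (at x) v"]
    by simp
  moreover have "h differentiable (at x)" if "x \<in> S" for x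
    using deriv[OF that] by (rule differentiableI)
  ultimately show ?case
    by simp
qed

lemma smooth_on_add:
  assumes "open S" "smooth_on S f" "smooth_on S g"
  shows "smooth_on S (\<lambda>x. f x + g x)"
  using assms Ck_on_add_cong[of S _ f g "\<lambda>x. f x + g x"] by (simp add: smooth_on_def)

lemma one_forms_add:
  assumes "smooth_atlas A" "\<alpha> \<in> one_forms A" "\<beta> \<in> one_forms A"
  shows "(\<lambda>p. \<alpha> p + \<beta> p) \<in> one_forms A"
proof -
  have "open (chart_image c)" if "c \<in> A" for c
    using assms(1) that by (simp add: smooth_atlas_def)
  then show ?thesis
    using assms(2,3) by (auto simp: one_forms_def Let_def blinfun.add_left intro!: smooth_on_add)
qed

text \<open>The sharp of \<open>a\<close> exists by the finite-dimensional fact that a nondegenerate bilinear form represents every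
  linear functional. Writing the form as \<open>B v w = T v \<bullet> w\<close> reduces it to injective linear
  endomorphisms being surjective.\<close>

lemma metric_sharp_represents:
  fixes gt :: "('m, 'e::euclidean_space) covariant2"
  assumes bil: "bilinear (gt p)" and nondeg: "\<And>v. (\<And>w. gt p v w = 0) \<Longrightarrow> v = 0"
  shows "blinfun_apply a w = gt p (metric_sharp gt p a) w"
proof -
  define T where "T v = (\<Sum>b\<in>Basis. gt p v b *\<^sub>R b)" for v
  have lin_right: "linear (gt p v)" and lin_left: "linear (\<lambda>v. gt p v w)" for v w
    using bil by (auto simp: bilinear_def)
  have basis_expansion: "f w = (\<Sum>b\<in>Basis. f b *\<^sub>R b) \<bullet> w" if "linear f" for f :: "'e \<Rightarrow> real" and w
  proof -
    have "f w = f (\<Sum>b\<in>Basis. (w \<bullet> b) *\<^sub>R b)"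
      by (simp add: euclidean_representation)
    also have "\<dots> = (\<Sum>b\<in>Basis. (w \<bullet> b) * f b)"
      using that by (simp add: linear_sum linear_scale)
    finally show ?thesis
      by (simp only: inner_sum_left inner_scaleR_left inner_commute[of w] mult.commute)
  qed
  have T: "gt p v w = T v \<bullet> w" for v w
    unfolding T_def by (rule basis_expansion[OF lin_right])
  have "linear T"
    unfolding T_def
    by (rule linearI)
      (simp_all add: linear_add[OF lin_left] linear_scale[OF lin_left] scaleR_add_left
        sum.distrib scaleR_sum_right)
  moreover from this have "inj T"
    using nondeg T by (auto simp: linear_injective_0)
  ultimately have "surj T"
    by (simp add: linear_injective_imp_surjective)
  then obtain v where v: "(\<Sum>b\<in>Basis. blinfun_apply a b *\<^sub>R b) = T v"
    by (rule surjE)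
  have represents: "\<forall>w. blinfun_apply a w = gt p v w"
    using basis_expansion[of "blinfun_apply a"] v T
    by (simp add: blinfun.bounded_linear_right bounded_linear.linear)
  moreover have "u = v" if "\<forall>w. blinfun_apply a w = gt p u w" for u
    using nondeg[of "u - v"] represents that linear_diff[OF lin_left] by simp
  ultimately have "\<forall>w. blinfun_apply a w = gt p (metric_sharp gt p a) w"
    unfolding metric_sharp_def by (rule theI)
  then show ?thesis
    by blast
qed

text \<open>The right-hand side involves no sharp of \<open>a\<close>, so additivity of the cometric in its first argument
  is that of evaluating covectors, and the second argument follows by symmetry.\<close>

lemma cometric_eq_apply_sharp:
  assumes "pseudo_riemannian_metric A gt"
  shows "cometric gt p a b = blinfun_apply a (metric_sharp gt p b)"
proof -
  have "bilinear (gt p)" "\<And>v. (\<And>w. gt p v w = 0) \<Longrightarrow> v = 0"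
    using assms unfolding pseudo_riemannian_metric_def by blast+
  then have "blinfun_apply a w = gt p (metric_sharp gt p a) w" for w
    by (rule metric_sharp_represents)
  then show ?thesis
    by (simp only: cometric_def)
qed

lemma cometric_commute:
  assumes "pseudo_riemannian_metric A gt"
  shows "cometric gt p a b = cometric gt p b a"
  using assms by (simp add: cometric_def pseudo_riemannian_metric_def)

lemma cometric_add_left:
  assumes "pseudo_riemannian_metric A gt"
  shows "cometric gt p (a + a') b = cometric gt p a b + cometric gt p a' b"
  by (simp add: cometric_eq_apply_sharp[OF assms] blinfun.add_left)

lemma cometric_add_right:
  assumes "pseudo_riemannian_metric A gt"
  shows "cometric gt p b (a + a') = cometric gt p b a + cometric gt p b a'"
  using cometric_add_left[OF assms] by (simp add: cometric_commute[OF assms, of p b])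

lemma cometric_diff_left:
  assumes "pseudo_riemannian_metric A gt"
  shows "cometric gt p (a - a') b = cometric gt p a b - cometric gt p a' b"
  by (simp add: cometric_eq_apply_sharp[OF assms] blinfun.diff_left)

lemma cometric_diff_right:
  assumes "pseudo_riemannian_metric A gt"
  shows "cometric gt p b (a - a') = cometric gt p b a - cometric gt p b a'"
  using cometric_diff_left[OF assms] by (simp add: cometric_commute[OF assms, of p b])

text \<open>The contravariant counterpart of the classical formula
  \<open>(L\<^sub>X g)(Y, Z) = g(\<nabla>\<^sub>Y X, Z) + g(Y, \<nabla>\<^sub>Z X)\<close>: torsion-freeness trades the brackets for
  covariant derivatives, and the derivatives in the direction \<open>\<eta>\<close> cancel by metricity.\<close>

lemma lie_derivative_cometric_levi_civita:
  assumes metric: "pseudo_riemannian_metric A gt"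
    and lc: "contravariant_levi_civita A (cometric gt) \<pi> D"
    and forms: "\<eta> \<in> one_forms A" "\<alpha> \<in> one_forms A" "\<beta> \<in> one_forms A"
  shows "lie_derivative_cometric A (cometric gt) \<pi> \<eta> \<alpha> \<beta> p
    = eval2 (cometric gt) (D \<alpha> \<eta>) \<beta> p + eval2 (cometric gt) \<alpha> (D \<beta> \<eta>) p"
proof -
  have torsion_free: "(\<lambda>p. D \<eta> \<gamma> p - D \<gamma> \<eta> p) = koszul_bracket A \<pi> \<eta> \<gamma>"
    if "\<gamma> \<in> one_forms A" for \<gamma>
    using lc forms(1) that unfolding contravariant_levi_civita_def by blast
  have "vf_apply A (poisson_sharp \<pi> \<eta>) (eval2 (cometric gt) \<alpha> \<beta>)
      = (\<lambda>p. eval2 (cometric gt) (D \<eta> \<alpha>) \<beta> p + eval2 (cometric gt) \<alpha> (D \<eta> \<beta>) p)"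
    using lc forms unfolding contravariant_levi_civita_def by blast
  then show ?thesis
    by (simp add: lie_derivative_cometric_def torsion_free[symmetric] forms eval2_def
        cometric_diff_left[OF metric] cometric_diff_right[OF metric])
qed

theorem proposition3p3:
  fixes A :: "('m::{t2_space, second_countable_topology}, 'e::euclidean_space) chart set"
    and g \<pi> :: "('m, 'e) contravariant2"
    and D :: "('m, 'e) covector_field \<Rightarrow> ('m, 'e) covector_field \<Rightarrow> ('m, 'e) covector_field"
    and \<eta> :: "('m, 'e) covector_field"
  assumes "riemannian_poisson_manifold A g \<pi>"
    and "contravariant_levi_civita A g \<pi> D"
    and "\<eta> \<in> one_forms A"
  shows "killing_form A g \<pi> \<eta> \<longleftrightarrow>
    (\<forall>\<alpha>\<in>one_forms A. eval2 g (D \<alpha> \<eta>) \<alpha> = (\<lambda>_. 0))"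
proof -
  from assms(1) obtain gt where atlas: "smooth_atlas A"
    and metric: "pseudo_riemannian_metric A gt" and g: "g = cometric gt"
    unfolding riemannian_poisson_manifold_def by blast
  note lie = lie_derivative_cometric_levi_civita[OF metric assms(2)[unfolded g] assms(3), folded g]
  note add = cometric_add_left[OF metric, folded g] cometric_add_right[OF metric, folded g]
  note commute = cometric_commute[OF metric, folded g]
  show ?thesis
  proof
    assume killing: "killing_form A g \<pi> \<eta>"
    show "\<forall>\<alpha>\<in>one_forms A. eval2 g (D \<alpha> \<eta>) \<alpha> = (\<lambda>_. 0)"
    proof (intro ballI ext)
      fix \<alpha> p assume \<alpha>: "\<alpha> \<in> one_forms A"
      have "eval2 g (D \<alpha> \<eta>) \<alpha> p + eval2 g \<alpha> (D \<alpha> \<eta>) p = 0"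
        using killing \<alpha> lie[OF \<alpha> \<alpha>, of p] by (simp add: killing_form_def)
      then show "eval2 g (D \<alpha> \<eta>) \<alpha> p = 0"
        by (simp add: eval2_def commute[of p "\<alpha> p"])
    qed
  next
    assume diagonal: "\<forall>\<alpha>\<in>one_forms A. eval2 g (D \<alpha> \<eta>) \<alpha> = (\<lambda>_. 0)"
    have "lie_derivative_cometric A g \<pi> \<eta> \<alpha> \<beta> p = 0"
      if \<alpha>: "\<alpha> \<in> one_forms A" and \<beta>: "\<beta> \<in> one_forms A" for \<alpha> \<beta> p
    proof -
      have null: "g p (D \<gamma> \<eta> p) (\<gamma> p) = 0" if "\<gamma> \<in> one_forms A" for \<gamma>
        using bspec[OF diagonal that] by (auto simp: eval2_def dest: fun_cong)
      have "D (\<lambda>p. \<alpha> p + \<beta> p) \<eta> = (\<lambda>p. D \<alpha> \<eta> p + D \<beta> \<eta> p)"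
        using assms(2,3) \<alpha> \<beta> unfolding contravariant_levi_civita_def by blast
      then have "g p (D \<alpha> \<eta> p + D \<beta> \<eta> p) (\<alpha> p + \<beta> p) = 0"
        using null[OF one_forms_add[OF atlas \<alpha> \<beta>]] by simp
      then have "g p (D \<alpha> \<eta> p) (\<beta> p) + g p (D \<beta> \<eta> p) (\<alpha> p) = 0"
        using null[OF \<alpha>] null[OF \<beta>] by (simp add: add)
      then show ?thesis
        by (simp add: lie[OF \<alpha> \<beta>] eval2_def commute[of p "\<alpha> p"])
    qed
    then show "killing_form A g \<pi> \<eta>"
      using assms(3) by (auto simp: killing_form_def)
  qed
qed

end
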